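(* Let $(A,\succ,\prec)$ be an anti-dendriform algebra, $E$ a vector space containing $A$ as a subspace and $(E,\succeq,\preceq)$ an anti-dendriform algebra such that $A$ is an anti-dendriform subalgebra of $E$. Then there exist a subspace $V$ of $E$ which is a complement of $A$ in $E$, an extending structure $\Omega(A,V)=(l_{\succ},r_{\succ},l_{\prec},r_{\prec},\rho_{\succ},\mu_{\succ},\rho_{\prec},\mu_{\prec},\varpi_1,\varpi_2,\succ_V,\prec_V)$ of $A$ through $V$, and an isomorphism of anti-dendriform algebras $(E,\succeq,\preceq)\cong A\natural V$ (with $A\natural V$ the unified product associated to $\Omega(A,V)$) that stabilizes $A$ and co-stabilizes $V$.
   Context: All vector spaces and algebras are over a field $k$, and all algebras are finite-dimensional. An anti-dendriform algebra $(A,\succ,\prec)$ is a vector space $A$ with two bilinear maps $\succ,\prec:A\times A\to A$ such that, writing $x\cdot y=x\succ y+x\prec y$, for all $x,y,z\in A$: $x\succ(y\succ z)=-(x\cdot y)\succ z=-x\prec(y\cdot z)=(x\prec y)\prec z$ and $(x\succ y)\prec z=x\succ(y\prec z)$. Homomorphisms are linear maps preserving both operations. An extending datum of $(A,\succ,\prec)$ through a vector space $V$ is a system $\Omega(A,V)=(l_{\succ},r_{\succ},l_{\prec},r_{\prec},\rho_{\succ},\mu_{\succ},\rho_{\prec},\mu_{\prec},\varpi_1,\varpi_2,\succ_V,\prec_V)$ of linear maps $l_{\succ},r_{\succ},l_{\prec},r_{\prec}:A\to \mathrm{End}(V)$, $\rho_{\succ},\mu_{\succ},\rho_{\prec},\mu_{\prec}:V\to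 \mathrm{End}(A)$ and bilinear maps $\varpi_1,\varpi_2:V\times V\to A$, $\succ_V,\prec_V:V\times V\to V$. Let $A\natural V$ be the vector space $A\oplus V$ with the bilinear operations (for $x,y\in A$, $a,b\in V$) $$(x,a)\succeq(y,b)=(x\succ y+\rho_{\succ}(a)y+\mu_{\succ}(b)x+\varpi_1(a,b),\ l_{\succ}(x)b+r_{\succ}(y)a+a\succ_V b),$$ $$(x,a)\preceq(y,b)=(x\prec y+\rho_{\prec}(a)y+\mu_{\prec}(b)x+\varpi_2(a,b),\ l_{\prec}(x)b+r_{\prec}(y)a+a\prec_V b).$$ If $(A\oplus V,\succeq,\preceq)$ is an anti-dendriform algebra, then $\Omega(A,V)$ is called an extending structure of $A$ through $V$ and $A\natural V$ the unified product of $A$ and $V$. If $V$ is a complement of $A$ in $E$, let $\pi:E\to V$ be the projection along $A$ and let $i$ denote the inclusion of $A$ in $E$; for $A\natural V$ use the canonical inclusion $x\mapsto(x,0)$ and projection $(x,a)\mapsto a$. A linear map between $E$ and $A\natural V$ stabilizes $A$ if it commutes with the inclusions of $A$ (identity on $A$), and co-stabilizes $V$ if it commutes with the projections onto $V$. *)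

theory Defs
  imports "HOL-Analysis.Product_Vector"
begin

text \<open>
  Vector spaces are subspaces (carrier sets) of an ambient type with a \<open>vector_space\<close> structure, so
  that an algebra, a subalgebra and a complement can be treated uniformly. Operations are total
  functions on the ambient type; only their values on the carriers are constrained.
\<close>

definition linear_on ::
  "('k::field \<Rightarrow> 'a::ab_group_add \<Rightarrow> 'a) \<Rightarrow> 'a set \<Rightarrow> ('k \<Rightarrow> 'b::ab_group_add \<Rightarrow> 'b) \<Rightarrow> 'b set \<Rightarrow> ('a \<Rightarrow> 'b) \<Rightarrow> bool"
  where "linear_on s S t T f \<longleftrightarrow>
    (\<forall>x\<in>S. f x \<in> T) \<and> (\<forall>x\<in>S. \<forall>y\<in>S. f (x + y) = f x + f y) \<and> (\<forall>c. \<forall>x\<in>S. f (s c x) = t c (f x))"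

definition bilinear_on ::
  "('k::field \<Rightarrow> 'a::ab_group_add \<Rightarrow> 'a) \<Rightarrow> 'a set \<Rightarrow> ('k \<Rightarrow> 'b::ab_group_add \<Rightarrow> 'b) \<Rightarrow> 'b set \<Rightarrow> ('a \<Rightarrow> 'a \<Rightarrow> 'b) \<Rightarrow> bool"
  where "bilinear_on s S t T f \<longleftrightarrow>
    (\<forall>x\<in>S. linear_on s S t T (f x)) \<and> (\<forall>y\<in>S. linear_on s S t T (\<lambda>x. f x y))"

definition End_on :: "('k::field \<Rightarrow> 'a::ab_group_add \<Rightarrow> 'a) \<Rightarrow> 'a set \<Rightarrow> ('a \<Rightarrow> 'a) set"
  where "End_on s S = {f. linear_on s S s S f}"

text \<open>
  Linear maps \<open>S \<rightarrow> End(T)\<close>. Elements of \<open>End(T)\<close> are compared, added and scaled pointwise on \<open>T\<close>.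
\<close>

definition linear_to_End ::
  "('k::field \<Rightarrow> 'a::ab_group_add \<Rightarrow> 'a) \<Rightarrow> 'a set \<Rightarrow> ('k \<Rightarrow> 'b::ab_group_add \<Rightarrow> 'b) \<Rightarrow> 'b set \<Rightarrow> ('a \<Rightarrow> 'b \<Rightarrow> 'b) \<Rightarrow> bool"
  where "linear_to_End s S t T f \<longleftrightarrow>
    (\<forall>x\<in>S. f x \<in> End_on t T) \<and>
    (\<forall>x\<in>S. \<forall>y\<in>S. \<forall>a\<in>T. f (x + y) a = f x a + f y a) \<and>
    (\<forall>c. \<forall>x\<in>S. \<forall>a\<in>T. f (s c x) a = t c (f x a))"

locale anti_dendriform_algebra = vector_space scale
  for scale :: "'k::field \<Rightarrow> 'a::ab_group_add \<Rightarrow> 'a" +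
  fixes A :: "'a set"
    and succ :: "'a \<Rightarrow> 'a \<Rightarrow> 'a"  (infixl \<open>\<succ>\<close> 70)
    and prec :: "'a \<Rightarrow> 'a \<Rightarrow> 'a"  (infixl \<open>\<prec>\<close> 70)
  assumes subspace_carrier: "subspace A"
    and finite_dim: "\<exists>B. finite B \<and> B \<subseteq> A \<and> span B = A"
    and bilinear_succ: "bilinear_on scale A scale A (\<succ>)"
    and bilinear_prec: "bilinear_on scale A scale A (\<prec>)"
    and succ_succ_1: "\<lbrakk>x \<in> A; y \<in> A; z \<in> A\<rbrakk> \<Longrightarrow> x \<succ> (y \<succ> z) = - ((x \<succ> y + x \<prec> y) \<succ> z)"
    and succ_succ_2: "\<lbrakk>x \<in> A; y \<in> A; z \<in> A\<rbrakk> \<Longrightarrow> x \<succ> (y \<succ> z) = - (x \<prec> (y \<succ> z + y \<prec> z))"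
    and succ_succ_3: "\<lbrakk>x \<in> A; y \<in> A; z \<in> A\<rbrakk> \<Longrightarrow> x \<succ> (y \<succ> z) = (x \<prec> y) \<prec> z"
    and succ_prec: "\<lbrakk>x \<in> A; y \<in> A; z \<in> A\<rbrakk> \<Longrightarrow> (x \<succ> y) \<prec> z = x \<succ> (y \<prec> z)"

definition anti_dendriform_subalgebra ::
  "('k::field \<Rightarrow> 'a::ab_group_add \<Rightarrow> 'a) \<Rightarrow> 'a set \<Rightarrow> ('a \<Rightarrow> 'a \<Rightarrow> 'a) \<Rightarrow> ('a \<Rightarrow> 'a \<Rightarrow> 'a) \<Rightarrow>
    'a set \<Rightarrow> ('a \<Rightarrow> 'a \<Rightarrow> 'a) \<Rightarrow> ('a \<Rightarrow> 'a \<Rightarrow> 'a) \<Rightarrow> bool"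
  where "anti_dendriform_subalgebra s A succA precA E succE precE \<longleftrightarrow>
    anti_dendriform_algebra s A succA precA \<and> anti_dendriform_algebra s E succE precE \<and> A \<subseteq> E \<and>
    (\<forall>x\<in>A. \<forall>y\<in>A. succA x y = succE x y \<and> precA x y = precE x y)"

definition anti_dendriform_hom ::
  "('k::field \<Rightarrow> 'a::ab_group_add \<Rightarrow> 'a) \<Rightarrow> 'a set \<Rightarrow> ('a \<Rightarrow> 'a \<Rightarrow> 'a) \<Rightarrow> ('a \<Rightarrow> 'a \<Rightarrow> 'a) \<Rightarrow>
    ('k \<Rightarrow> 'b::ab_group_add \<Rightarrow> 'b) \<Rightarrow> 'b set \<Rightarrow> ('b \<Rightarrow> 'b \<Rightarrow> 'b) \<Rightarrow> ('b \<Rightarrow> 'b \<Rightarrow> 'b) \<Rightarrow> ('a \<Rightarrow> 'b) \<Rightarrow> bool"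
  where "anti_dendriform_hom s A succA precA t B succB precB f \<longleftrightarrow>
    linear_on s A t B f \<and>
    (\<forall>x\<in>A. \<forall>y\<in>A. f (succA x y) = succB (f x) (f y)) \<and>
    (\<forall>x\<in>A. \<forall>y\<in>A. f (precA x y) = precB (f x) (f y))"

definition anti_dendriform_iso ::
  "('k::field \<Rightarrow> 'a::ab_group_add \<Rightarrow> 'a) \<Rightarrow> 'a set \<Rightarrow> ('a \<Rightarrow> 'a \<Rightarrow> 'a) \<Rightarrow> ('a \<Rightarrow> 'a \<Rightarrow> 'a) \<Rightarrow>
    ('k \<Rightarrow> 'b::ab_group_add \<Rightarrow> 'b) \<Rightarrow> 'b set \<Rightarrow> ('b \<Rightarrow> 'b \<Rightarrow> 'b) \<Rightarrow> ('b \<Rightarrow> 'b \<Rightarrow> 'b) \<Rightarrow> ('a \<Rightarrow> 'b) \<Rightarrow> bool"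
  where "anti_dendriform_iso s A succA precA t B succB precB f \<longleftrightarrow>
    anti_dendriform_hom s A succA precA t B succB precB f \<and> bij_betw f A B"

record ('a, 'v) datum =
  l_succ :: "'a \<Rightarrow> 'v \<Rightarrow> 'v"
  r_succ :: "'a \<Rightarrow> 'v \<Rightarrow> 'v"
  l_prec :: "'a \<Rightarrow> 'v \<Rightarrow> 'v"
  r_prec :: "'a \<Rightarrow> 'v \<Rightarrow> 'v"
  rho_succ :: "'v \<Rightarrow> 'a \<Rightarrow> 'a"
  mu_succ :: "'v \<Rightarrow> 'a \<Rightarrow> 'a"
  rho_prec :: "'v \<Rightarrow> 'a \<Rightarrow> 'a"
  mu_prec :: "'v \<Rightarrow> 'a \<Rightarrow> 'a"
  varpi1 :: "'v \<Rightarrow> 'v \<Rightarrow> 'a"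
  varpi2 :: "'v \<Rightarrow> 'v \<Rightarrow> 'a"
  succ_V :: "'v \<Rightarrow> 'v \<Rightarrow> 'v"
  prec_V :: "'v \<Rightarrow> 'v \<Rightarrow> 'v"

locale extending_datum =
  A: anti_dendriform_algebra sA A succA precA + V: vector_space sV
  for sA :: "'k::field \<Rightarrow> 'a::ab_group_add \<Rightarrow> 'a" and A succA precA
    and sV :: "'k \<Rightarrow> 'v::ab_group_add \<Rightarrow> 'v" +
  fixes V :: "'v set" and \<Omega> :: "('a, 'v) datum"
  assumes subspace_V: "V.subspace V"
    and l_succ: "linear_to_End sA A sV V (l_succ \<Omega>)"
    and r_succ: "linear_to_End sA A sV V (r_succ \<Omega>)"
    and l_prec: "linear_to_End sA A sV V (l_prec \<Omega>)"
    and r_prec: "linear_to_End sA A sV V (r_prec \<Omega>)"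
    and rho_succ: "linear_to_End sV V sA A (rho_succ \<Omega>)"
    and mu_succ: "linear_to_End sV V sA A (mu_succ \<Omega>)"
    and rho_prec: "linear_to_End sV V sA A (rho_prec \<Omega>)"
    and mu_prec: "linear_to_End sV V sA A (mu_prec \<Omega>)"
    and varpi1: "bilinear_on sV V sA A (varpi1 \<Omega>)"
    and varpi2: "bilinear_on sV V sA A (varpi2 \<Omega>)"
    and succ_V: "bilinear_on sV V sV V (succ_V \<Omega>)"
    and prec_V: "bilinear_on sV V sV V (prec_V \<Omega>)"

fun unified_succ ::
  "('a::ab_group_add \<Rightarrow> 'a \<Rightarrow> 'a) \<Rightarrow> ('a, 'v::ab_group_add) datum \<Rightarrow> 'a \<times> 'v \<Rightarrow> 'a \<times> 'v \<Rightarrow> 'a \<times> 'v"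
  where "unified_succ succA \<Omega> (x, a) (y, b) =
    (succA x y + rho_succ \<Omega> a y + mu_succ \<Omega> b x + varpi1 \<Omega> a b,
     l_succ \<Omega> x b + r_succ \<Omega> y a + succ_V \<Omega> a b)"

fun unified_prec ::
  "('a::ab_group_add \<Rightarrow> 'a \<Rightarrow> 'a) \<Rightarrow> ('a, 'v::ab_group_add) datum \<Rightarrow> 'a \<times> 'v \<Rightarrow> 'a \<times> 'v \<Rightarrow> 'a \<times> 'v"
  where "unified_prec precA \<Omega> (x, a) (y, b) =
    (precA x y + rho_prec \<Omega> a y + mu_prec \<Omega> b x + varpi2 \<Omega> a b,
     l_prec \<Omega> x b + r_prec \<Omega> y a + prec_V \<Omega> a b)"

definition extending_structure ::
  "('k::field \<Rightarrow> 'a::ab_group_add \<Rightarrow> 'a) \<Rightarrow> 'a set \<Rightarrow> ('a \<Rightarrow> 'a \<Rightarrow> 'a) \<Rightarrow> ('a \<Rightarrow> 'a \<Rightarrow> 'a) \<Rightarrow>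
    ('k \<Rightarrow> 'v::ab_group_add \<Rightarrow> 'v) \<Rightarrow> 'v set \<Rightarrow> ('a, 'v) datum \<Rightarrow> bool"
  where "extending_structure sA A succA precA sV V \<Omega> \<longleftrightarrow>
    extending_datum sA A succA precA sV V \<Omega> \<and>
    anti_dendriform_algebra (module_prod.scale sA sV) (A \<times> V)
      (unified_succ succA \<Omega>) (unified_prec precA \<Omega>)"

definition is_complement ::
  "('k::field \<Rightarrow> 'a::ab_group_add \<Rightarrow> 'a) \<Rightarrow> 'a set \<Rightarrow> 'a set \<Rightarrow> 'a set \<Rightarrow> bool"
  where "is_complement s E A V \<longleftrightarrow>
    module.subspace s V \<and> V \<subseteq> E \<and> A \<inter> V = {0} \<and> {x + v |x v. x \<in> A \<and> v \<in> V} = E"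

text \<open>The projection onto \<open>V\<close> along \<open>A\<close>; it is determined when \<open>V\<close> is a complement of \<open>A\<close>.\<close>

definition proj_along :: "'a::ab_group_add set \<Rightarrow> 'a set \<Rightarrow> 'a \<Rightarrow> 'a"
  where "proj_along A V e = (THE v. v \<in> V \<and> e - v \<in> A)"

definition stabilizes :: "'a set \<Rightarrow> ('a \<Rightarrow> 'a \<times> 'v::zero) \<Rightarrow> bool"
  where "stabilizes A \<phi> \<longleftrightarrow> (\<forall>x\<in>A. \<phi> x = (x, 0))"

definition co_stabilizes :: "'a::ab_group_add set \<Rightarrow> 'a set \<Rightarrow> 'a set \<Rightarrow> ('a \<Rightarrow> 'a \<times> 'a) \<Rightarrow> bool"
  where "co_stabilizes E A V \<phi> \<longleftrightarrow> (\<forall>e\<in>E. snd (\<phi> e) = proj_along A V e)"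

end

theory Submission
  imports Defs
begin

text \<open>
  A subspace \<open>A\<close> of \<open>E\<close> is the image of a linear idempotent \<open>q\<close>, and \<open>V = ker q\<close> is a complement
  with projection \<open>p = id - q\<close>. The linear isomorphism \<open>\<phi> e = (q e, p e)\<close> from \<open>E\<close> to \<open>A \<times> V\<close>, with
  inverse \<open>(x, a) \<mapsto> x + a\<close>, sends \<open>x\<close> in \<open>A\<close> to \<open>(x, 0)\<close> and has \<open>p\<close> as second component, so it
  stabilizes \<open>A\<close> and co-stabilizes \<open>V\<close>.

  The operations of \<open>A \<times> V\<close> are then forced: a product of \<open>x + a\<close> and \<open>y + b\<close> in \<open>E\<close> splits by
  bilinearity into the four products of \<open>x, a\<close> with \<open>y, b\<close>, each of which has a component in \<open>A\<close> and
  one in \<open>V\<close>. Because \<open>A\<close> is a subalgebra, the product of \<open>x\<close> and \<open>y\<close> is the product in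
  \<open>A\<close>, with no component in \<open>V\<close>; the six components of the other three products are exactly the
  maps that an extending datum provides for each operation (lemma \<open>extending_datum_split\<close>), and
  \<open>\<phi>\<close> is multiplicative by construction (lemma \<open>unified_split\<close>).

  It remains to see that the unified product is an anti-dendriform algebra. No compatibility condition
  among the structure maps has to be computed: the anti-dendriform identities are equations, so they
  pass from \<open>E\<close> to its image under \<open>\<phi>\<close> (lemma \<open>anti_dendriform_algebra_image\<close>).
\<close>

section \<open>Homomorphic images\<close>

lemma linear_on_scale:
  assumes "linear_on s S t T f" "x \<in> S"
  shows "f (s c x) = t c (f x)"
  using assms by (simp add: linear_on_def)

lemma linear_on_zero:
  assumes "vector_space s" "vector_space t" "linear_on s S t T f" "0 \<in> S"
  shows "f 0 = 0"
proof -
  interpret s: vector_space s by fact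
  interpret t: vector_space t by fact
  have "f (s 0 0) = t 0 (f 0)" by (rule linear_on_scale[OF assms(3,4)])
  then show ?thesis by simp
qed

lemma linear_on_image_subspace:
  assumes "vector_space s" "vector_space t" "linear_on s S t T f" "module.subspace s S"
  shows "module.subspace t (f ` S)"
proof -
  interpret s: vector_space s by fact
  interpret t: vector_space t by fact
  have add: "f x + f y = f (x + y)" if "x \<in> S" "y \<in> S" for x y
    using assms(3) that by (simp add: linear_on_def)
  have scale: "t c (f x) = f (s c x)" if "x \<in> S" for c x
    using assms(3) that by (simp add: linear_on_def)
  show ?thesis
  proof (rule t.subspaceI)
    show "0 \<in> f ` S"
      using linear_on_zero[OF assms(1-3)] s.subspace_0[OF assms(4)] by force
  qed (use assms(4) in \<open>auto simp: add scale s.subspace_add s.subspace_scale\<close>)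
qed

lemma linear_on_span_image:
  assumes "vector_space s" "vector_space t" "linear_on s S t T f"
    and "B \<subseteq> S" and span: "module.span s B = S"
  shows "module.span t (f ` B) = f ` S"
proof -
  interpret s: vector_space s by fact
  interpret t: vector_space t by fact
  have sub: "s.subspace S" using span s.subspace_span by metis
  have "x \<in> S \<and> f x \<in> t.span (f ` B)" if "x \<in> s.span B" for x
    using that
  proof (induction rule: s.span_induct_alt)
    case base
    then show ?case
      using linear_on_zero[OF assms(1-3)] s.subspace_0[OF sub] by (simp add: t.span_zero)
  next
    case (step c x y)
    then have "x \<in> S" using assms(4) by blast
    then have "f (s c x + y) = t c (f x) + f y"
      using assms(3) step s.subspace_scale[OF sub] by (simp add: linear_on_def)
    with step \<open>x \<in> S\<close> show ?case
      by (simp add: s.subspace_add[OF sub] s.subspace_scale[OF sub]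
          t.span_add t.span_scale t.span_base)
  qed
  then have "f ` S \<subseteq> t.span (f ` B)" using span by blast
  moreover have "t.span (f ` B) \<subseteq> f ` S"
    using assms(4) by (intro t.span_minimal linear_on_image_subspace[OF assms(1-3) sub]) blast
  ultimately show ?thesis by blast
qed

lemma bilinear_on_image:
  assumes "vector_space s" and "linear_on s S t T f" and "module.subspace s S"
    and "bilinear_on s S s S m"
    and "\<And>x y. x \<in> S \<Longrightarrow> y \<in> S \<Longrightarrow> f (m x y) = n (f x) (f y)"
  shows "bilinear_on t (f ` S) t (f ` S) n"
proof -
  interpret s: vector_space s by fact
  have m_closed: "m x y \<in> S" if "x \<in> S" "y \<in> S" for x y
    using assms(4) that by (simp add: bilinear_on_def linear_on_def)
  have f_add: "f x + f y = f (x + y)" if "x \<in> S" "y \<in> S" for x y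
    using assms(2) that by (simp add: linear_on_def)
  have f_scale: "t c (f x) = f (s c x)" if "x \<in> S" for c x
    using assms(2) that by (simp add: linear_on_def)
  have m_add: "m (x + y) z = m x z + m y z" "m z (x + y) = m z x + m z y"
    if "x \<in> S" "y \<in> S" "z \<in> S" for x y z
    using assms(4) that by (simp_all add: bilinear_on_def linear_on_def)
  have m_scale: "m (s c x) z = s c (m x z)" "m z (s c x) = s c (m z x)"
    if "x \<in> S" "z \<in> S" for c x z
    using assms(4) that by (simp_all add: bilinear_on_def linear_on_def)
  show ?thesis
    unfolding bilinear_on_def linear_on_def
    by (auto simp: f_add f_scale assms(5)[symmetric] m_closed m_add m_scale
        s.subspace_add[OF assms(3)] s.subspace_scale[OF assms(3)])
qed

text \<open>
  Each anti-dendriform identity is an equation at arbitrary elements, and all elements of the image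
  have preimages, while a finite spanning set maps to a spanning set of the image; the lemma
  therefore applies to quotients as well as to isomorphic copies.
\<close>

lemma anti_dendriform_algebra_image:
  assumes "anti_dendriform_algebra s S succS precS" and "vector_space t"
    and hom: "anti_dendriform_hom s S succS precS t T succT precT f"
    and onto: "f ` S = T"
  shows "anti_dendriform_algebra t T succT precT"
proof -
  interpret S: anti_dendriform_algebra s S succS precS by fact
  interpret t: vector_space t by fact
  note vs = S.vector_space_axioms \<open>vector_space t\<close>
  have lin: "linear_on s S t T f"
    and succ: "\<And>x y. x \<in> S \<Longrightarrow> y \<in> S \<Longrightarrow> f (succS x y) = succT (f x) (f y)"
    and prec: "\<And>x y. x \<in> S \<Longrightarrow> y \<in> S \<Longrightarrow> f (precS x y) = precT (f x) (f y)"
    using hom by (auto simp: anti_dendriform_hom_def)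
  have closed: "succS x y \<in> S" "precS x y \<in> S" if "x \<in> S" "y \<in> S" for x y
    using S.bilinear_succ S.bilinear_prec that by (auto simp: bilinear_on_def linear_on_def)
  have add: "f x + f y = f (x + y)" "x + y \<in> S" if "x \<in> S" "y \<in> S" for x y
    using lin that S.subspace_add[OF S.subspace_carrier] by (auto simp: linear_on_def)
  have neg: "- f x = f (- x)" if "x \<in> S" for x
  proof -
    have "f (s (- 1) x) = t (- 1) (f x)" by (rule linear_on_scale[OF lin that])
    then show ?thesis by simp
  qed
  note push = succ[symmetric] prec[symmetric] add neg closed
  show ?thesis
  proof
    show "t.subspace T"
      using linear_on_image_subspace[OF vs lin S.subspace_carrier] onto by simp
    obtain B where "finite B" "B \<subseteq> S" "S.span B = S" using S.finite_dim by blast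
    then show "\<exists>B. finite B \<and> B \<subseteq> T \<and> t.span B = T"
      using linear_on_span_image[OF vs lin, of B] onto by (intro exI[of _ "f ` B"]) auto
    show "bilinear_on t T t T succT"
      using bilinear_on_image[where f = f and m = succS and n = succT,
          OF vs(1) lin S.subspace_carrier S.bilinear_succ succ] onto
      by simp
    show "bilinear_on t T t T precT"
      using bilinear_on_image[where f = f and m = precS and n = precT,
          OF vs(1) lin S.subspace_carrier S.bilinear_prec prec] onto
      by simp
  next
    fix u v w assume "u \<in> T" "v \<in> T" "w \<in> T"
    then obtain x y z where xyz: "x \<in> S" "y \<in> S" "z \<in> S" and uvw: "u = f x" "v = f y" "w = f z"
      using onto by blast
    show "succT u (succT v w) = - succT (succT u v + precT u v) w"
      using S.succ_succ_1[OF xyz] xyz unfolding uvw by (simp add: push)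
    show "succT u (succT v w) = - precT u (succT v w + precT v w)"
      using S.succ_succ_2[OF xyz] xyz unfolding uvw by (simp add: push)
    show "succT u (succT v w) = precT (precT u v) w"
      using S.succ_succ_3[OF xyz] xyz unfolding uvw by (simp add: push)
    show "precT (succT u v) w = succT u (precT v w)"
      using S.succ_prec[OF xyz] xyz unfolding uvw by (simp add: push)
  qed
qed

section \<open>Splitting along a linear retraction\<close>

text \<open>
  All structure maps of the extending datum are products in \<open>E\<close> followed by the projection to \<open>A\<close> or
  to \<open>V\<close>, so this lemma and the next give all their linearity conditions.
\<close>

lemma bilinear_on_component:
  assumes "bilinear_on s UNIV s UNIV m" "Vector_Spaces.linear s s p" "range p \<subseteq> T"
  shows "bilinear_on s S s T (\<lambda>x y. p (m x y))"
proof -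
  interpret p: Vector_Spaces.linear s s p by fact
  show ?thesis
    using assms(1,3) by (auto simp: bilinear_on_def linear_on_def p.add p.scale)
qed

lemma linear_to_End_component:
  assumes "bilinear_on s UNIV s UNIV m" "Vector_Spaces.linear s s p" "range p \<subseteq> T"
  shows "linear_to_End s S s T (\<lambda>x a. p (m x a))"
    and "linear_to_End s S s T (\<lambda>x a. p (m a x))"
proof -
  interpret p: Vector_Spaces.linear s s p by fact
  show "linear_to_End s S s T (\<lambda>x a. p (m x a))" "linear_to_End s S s T (\<lambda>x a. p (m a x))"
    using assms(1,3)
    by (auto simp: linear_to_End_def End_on_def bilinear_on_def linear_on_def p.add p.scale)
qed

locale split_anti_dendriform =
  E: anti_dendriform_algebra scale UNIV succE precE + q: Vector_Spaces.linear scale scale q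
  for scale :: "'k::field \<Rightarrow> 'e::ab_group_add \<Rightarrow> 'e"
    and A :: "'e set" and succA precA succE precE :: "'e \<Rightarrow> 'e \<Rightarrow> 'e" and q :: "'e \<Rightarrow> 'e" +
  assumes subalgebra: "anti_dendriform_subalgebra scale A succA precA UNIV succE precE"
    and q_in: "q e \<in> A"
    and q_id: "x \<in> A \<Longrightarrow> q x = x"
begin

sublocale A: anti_dendriform_algebra scale A succA precA
  using subalgebra by (simp add: anti_dendriform_subalgebra_def)

sublocale EE: vector_space_prod scale scale ..

definition p :: "'e \<Rightarrow> 'e" where "p e = e - q e"

definition V :: "'e set" where "V = {v. q v = 0}"

definition datum :: "('e, 'e) datum" where
  "datum = \<lparr>
    l_succ = \<lambda>x b. p (succE x b), r_succ = \<lambda>y a. p (succE a y),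
    l_prec = \<lambda>x b. p (precE x b), r_prec = \<lambda>y a. p (precE a y),
    rho_succ = \<lambda>a y. q (succE a y), mu_succ = \<lambda>b x. q (succE x b),
    rho_prec = \<lambda>a y. q (precE a y), mu_prec = \<lambda>b x. q (precE x b),
    varpi1 = \<lambda>a b. q (succE a b), varpi2 = \<lambda>a b. q (precE a b),
    succ_V = \<lambda>a b. p (succE a b), prec_V = \<lambda>a b. p (precE a b)\<rparr>"

definition \<phi> :: "'e \<Rightarrow> 'e \<times> 'e" where "\<phi> e = (q e, p e)"

lemma p_in: "p e \<in> V"
  by (simp add: p_def V_def q.diff q_id q_in)

lemma p_zero: "x \<in> A \<Longrightarrow> p x = 0"
  by (simp add: p_def q_id)

lemma linear_p: "Vector_Spaces.linear scale scale p"
  by unfold_locales (simp_all add: p_def q.add q.scale E.scale_right_diff_distrib add_diff_add)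

sublocale p: Vector_Spaces.linear scale scale p
  by (rule linear_p)

lemma subspace_V: "E.subspace V"
  by (rule E.subspaceI) (simp_all add: V_def q.zero q.add q.scale)

lemma complement_V: "is_complement scale UNIV A V"
proof -
  have "e \<in> {x + v |x v. x \<in> A \<and> v \<in> V}" for e
    using q_in[of e] p_in[of e] by (force simp: p_def)
  moreover have "A \<inter> V = {0}"
    using E.subspace_0[OF A.subspace_carrier] by (auto simp: V_def q.zero q_id)
  ultimately show ?thesis
    using subspace_V by (auto simp: is_complement_def)
qed

lemma proj_along_eq_p: "proj_along A V e = p e"
  unfolding proj_along_def
proof (rule the_equality)
  show "p e \<in> V \<and> e - p e \<in> A" using p_in q_in by (simp add: p_def)
next
  fix v assume "v \<in> V \<and> e - v \<in> A"
  then have "q v = 0" and "q (e - v) = e - v" by (auto simp: V_def q_id)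
  then show "v = p e" by (simp add: q.diff p_def)
qed

lemma extending_datum_split: "extending_datum scale A succA precA scale V datum"
proof -
  have "range q \<subseteq> A" "range p \<subseteq> V" using q_in p_in by auto
  note into_A = q.linear_axioms \<open>range q \<subseteq> A\<close> and into_V = linear_p \<open>range p \<subseteq> V\<close>
  show ?thesis
    by unfold_locales
      (simp_all add: datum_def subspace_V
        linear_to_End_component[OF E.bilinear_succ into_A]
        linear_to_End_component[OF E.bilinear_succ into_V]
        linear_to_End_component[OF E.bilinear_prec into_A]
        linear_to_End_component[OF E.bilinear_prec into_V]
        bilinear_on_component[OF E.bilinear_succ into_A]
        bilinear_on_component[OF E.bilinear_succ into_V]
        bilinear_on_component[OF E.bilinear_prec into_A]
        bilinear_on_component[OF E.bilinear_prec into_V])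
qed

text \<open>
  Closure of \<open>A\<close> under the product makes \<open>p\<close> vanish on products of elements of \<open>A\<close>. This is why
  the formula for the unified product has four summands in \<open>A\<close> but only three in \<open>V\<close>.
\<close>

lemma phi_product:
  assumes "bilinear_on scale UNIV scale UNIV m"
    and closed: "\<And>x y. x \<in> A \<Longrightarrow> y \<in> A \<Longrightarrow> m x y \<in> A"
  shows "\<phi> (m d e) =
    (m (q d) (q e) + q (m (p d) (q e)) + q (m (q d) (p e)) + q (m (p d) (p e)),
     p (m (q d) (p e)) + p (m (p d) (q e)) + p (m (p d) (p e)))"
proof -
  have add: "m (x + y) z = m x z + m y z" "m z (x + y) = m z x + m z y" for x y z
    using assms(1) by (auto simp: bilinear_on_def linear_on_def)
  have "m d e = m (q d + p d) (q e + p e)" by (simp add: p_def)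
  also have "\<dots> = m (q d) (q e) + m (p d) (q e) + m (q d) (p e) + m (p d) (p e)"
    by (simp only: add ac_simps)
  finally have split: "m d e = \<dots>" .
  have "m (q d) (q e) \<in> A" by (simp add: closed q_in)
  then show ?thesis
    by (simp only: \<phi>_def split) (simp add: q.add p.add q_id p_zero)
qed

lemma unified_split:
  shows unified_succ_split: "unified_succ succA datum (\<phi> d) (\<phi> e) = \<phi> (succE d e)"
    and unified_prec_split: "unified_prec precA datum (\<phi> d) (\<phi> e) = \<phi> (precE d e)"
proof -
  have eq: "succE x y = succA x y" "precE x y = precA x y"
    and closed: "succE x y \<in> A" "precE x y \<in> A" if "x \<in> A" "y \<in> A" for x y
    using that subalgebra A.bilinear_succ A.bilinear_prec
    by (auto simp: anti_dendriform_subalgebra_def bilinear_on_def linear_on_def)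
  show "unified_succ succA datum (\<phi> d) (\<phi> e) = \<phi> (succE d e)"
    by (subst phi_product[OF E.bilinear_succ closed(1)])
      (simp_all add: \<phi>_def datum_def eq q_in)
  show "unified_prec precA datum (\<phi> d) (\<phi> e) = \<phi> (precE d e)"
    by (subst phi_product[OF E.bilinear_prec closed(2)])
      (simp_all add: \<phi>_def datum_def eq q_in)
qed

lemma bij_phi: "bij_betw \<phi> UNIV (A \<times> V)"
proof (rule bij_betw_byWitness[where f' = "\<lambda>(x, a). x + a"])
  show "\<forall>y\<in>A \<times> V. \<phi> ((\<lambda>(x, a). x + a) y) = y"
    by (auto simp: \<phi>_def V_def p_def q.add q_id)
qed (auto simp: \<phi>_def p_def q_in p_in[unfolded p_def])

lemma iso_phi:
  "anti_dendriform_iso scale UNIV succE precE EE.scale (A \<times> V)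
    (unified_succ succA datum) (unified_prec precA datum) \<phi>"
proof -
  have "linear_on scale UNIV EE.scale (A \<times> V) \<phi>"
    by (auto simp: linear_on_def \<phi>_def q_in p_in q.add p.add q.scale p.scale EE.scale_def)
  then show ?thesis
    by (simp add: anti_dendriform_iso_def anti_dendriform_hom_def bij_phi
        unified_succ_split unified_prec_split)
qed

lemma extending_structure_split: "extending_structure scale A succA precA scale V datum"
  using extending_datum_split iso_phi
    anti_dendriform_algebra_image[OF E.anti_dendriform_algebra_axioms EE.p.vector_space_axioms]
  by (auto simp: extending_structure_def anti_dendriform_iso_def bij_betw_def)

end

section \<open>Existence of an extending structure\<close>

theorem theorem3p4:
  fixes scale :: "'k::field \<Rightarrow> 'e::ab_group_add \<Rightarrow> 'e"
    and A :: "'e set"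
    and succA precA succE precE :: "'e \<Rightarrow> 'e \<Rightarrow> 'e"
  assumes "vector_space scale"
    and "anti_dendriform_algebra scale A succA precA"
    and "anti_dendriform_algebra scale UNIV succE precE"
    and "anti_dendriform_subalgebra scale A succA precA UNIV succE precE"
  shows "\<exists>(V :: 'e set) (\<Omega> :: ('e, 'e) datum) (\<phi> :: 'e \<Rightarrow> 'e \<times> 'e).
    is_complement scale UNIV A V \<and>
    extending_structure scale A succA precA scale V \<Omega> \<and>
    anti_dendriform_iso scale UNIV succE precE
      (module_prod.scale scale scale) (A \<times> V) (unified_succ succA \<Omega>) (unified_prec precA \<Omega>) \<phi> \<and>
    stabilizes A \<phi> \<and> co_stabilizes UNIV A V \<phi>"
proof -
  interpret A: anti_dendriform_algebra scale A succA precA by fact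
  interpret E: anti_dendriform_algebra scale UNIV succE precE by fact
  interpret EE: vector_space_pair scale scale ..
  have "Vector_Spaces.linear scale scale (\<lambda>x. x)" by unfold_locales simp_all
  note left_inverse = EE.linear_exists_left_inverse_on[OF this A.subspace_carrier]
  \<comment> \<open>A left inverse of the inclusion of \<open>A\<close> is a linear retraction of \<open>E\<close> onto \<open>A\<close>.\<close>
  obtain q where "range q \<subseteq> A" and "Vector_Spaces.linear scale scale q" and "\<forall>x\<in>A. q x = x"
    using left_inverse by auto
  then interpret split_anti_dendriform scale A succA precA succE precE q
    using assms by (intro split_anti_dendriform.intro split_anti_dendriform_axioms.intro) auto
  have "stabilizes A \<phi>"
    by (simp add: stabilizes_def \<phi>_def q_id p_zero)
  moreover have "co_stabilizes UNIV A V \<phi>"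
    by (simp add: co_stabilizes_def \<phi>_def proj_along_eq_p)
  ultimately show ?thesis
    using complement_V extending_structure_split iso_phi by blast
qed

end
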